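(* Consider the semi-discrete scheme $\frac{d\boldsymbol{u}_i}{dt}=\frac{1}{\Delta x}\left(\mathbf{A}\boldsymbol{u}_{i-2}+\mathbf{B}\boldsymbol{u}_{i-1}+\mathbf{C}\boldsymbol{u}_i+\mathbf{D}\boldsymbol{u}_{i+1}\right)$ for $u_t+u_x=0$ described in the context. Both of the following fully discrete schemes obtained from it are unstable: (i) the scheme obtained with the standard forward Euler time discretization, and (ii) the scheme obtained with the standard third-order strong-stability-preserving (SSP) Runge-Kutta time discretization. That is, for each of the two schemes there is no ratio $\nu=\Delta t/\Delta x>0$ for which the scheme is stable.
   Context: Equation and mesh: $u_t+u_x=0$ for $x\in[0,2\pi]$, $t>0$, with periodic boundary conditions, on a uniform mesh of $N$ cells ($N\ge 4$) $I_i=[x_{i-1/2},x_{i+1/2}]$ with length $\Delta x=2\pi/N$ and center $x_i$; all cell indices are understood modulo $N$. Unknowns: $\boldsymbol{u}_i=(\bar u_i,\bar v_i)^{\mathsf T}$, approximating the zeroth-order moment $\bar u_i(t)=\frac{1}{\Delta x}\int_{I_i}u(x,t)\,dx$ and the first-order moment $\bar v_i(t)=\frac{1}{\Delta x}\int_{I_i}u(x,t)\frac{x-x_i}{\Delta x}\,dx$. Semi-discrete scheme: $$\frac{d\bar u_i}{dt}=-\frac{1}{\Delta x}\left(u^-_{i+1/2}-u^-_{i-1/2}\right),\qquad \frac{d\bar v_i}{dt}=-\frac{1}{2\Delta x}\left(u^-_{i-1/2}+u^-_{i+1/2}\right)+\frac{1}{\Delta x}\bar u_i,$$ with the linear reconstruction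 $$u^-_{i+1/2}=-\tfrac{79}{456}\bar u_{i-1}+\tfrac{7}{12}\bar u_i+\tfrac{269}{456}\bar u_{i+1}-\tfrac{63}{76}\bar v_{i-1}-\tfrac{177}{76}\bar v_{i+1}.$$ Equivalently, $\frac{d\boldsymbol{u}_i}{dt}=L(\boldsymbol{u})_i:=\frac{1}{\Delta x}\left(\mathbf{A}\boldsymbol{u}_{i-2}+\mathbf{B}\boldsymbol{u}_{i-1}+\mathbf{C}\boldsymbol{u}_i+\mathbf{D}\boldsymbol{u}_{i+1}\right)$ with $$\mathbf{A}=\begin{bmatrix}-\frac{79}{456}&-\frac{63}{76}\\ \frac{79}{912}&\frac{63}{152}\end{bmatrix},\quad \mathbf{B}=\begin{bmatrix}\frac{115}{152}&\frac{63}{76}\\ -\frac{187}{912}&\frac{63}{152}\end{bmatrix},\quad \mathbf{C}=\begin{bmatrix}\frac{1}{152}&-\frac{177}{76}\\ \frac{377}{912}&\frac{177}{152}\end{bmatrix},\quad \mathbf{D}=\begin{bmatrix}-\frac{269}{456}&\frac{177}{76}\\ -\frac{269}{912}&\frac{177}{152}\end{bmatrix}.$$ Time discretizations with time step $\Delta t>0$: Forward Euler: $\boldsymbol{u}^{n+1}=\boldsymbol{u}^n+\Delta t\,L(\boldsymbol{u}^n)$. Third-order SSP Runge-Kutta: $\boldsymbol{u}^{(1)}=\boldsymbol{u}^n+\Delta t\,L(\boldsymbol{u}^n)$, $\boldsymbol{u}^{(2)}=\frac34\boldsymbol{u}^n+\frac14\left(\boldsymbol{u}^{(1)}+\Delta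 t\,L(\boldsymbol{u}^{(1)})\right)$, $\boldsymbol{u}^{n+1}=\frac13\boldsymbol{u}^n+\frac23\left(\boldsymbol{u}^{(2)}+\Delta t\,L(\boldsymbol{u}^{(2)})\right)$. Stability: for a fixed ratio $\nu=\Delta t/\Delta x>0$, the fully discrete scheme is called stable if for every $T>0$ there is a constant $C_T$, independent of $N$, such that for all $N\ge 4$ (with $\Delta x=2\pi/N$, $\Delta t=\nu\Delta x$), all initial data $\boldsymbol{u}^0$ and all $n\ge 0$ with $n\Delta t\le T$, one has $\left(\Delta x\sum_i|\boldsymbol{u}^n_i|^2\right)^{1/2}\le C_T\left(\Delta x\sum_i|\boldsymbol{u}^0_i|^2\right)^{1/2}$. *)

theory Defs
  imports "HOL-Analysis.Analysis"
begin

text \<open>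
  A grid function assigns to every cell \<open>i\<close> the pair of moments \<open>(ubar\<^sub>i, vbar\<^sub>i)\<close>.  Cell indices
  modulo \<open>N\<close> are rendered by \<open>N\<close>-periodic functions on the integers, one period being
  \<open>{0..<int N}\<close>.
\<close>

type_synonym grid = "int \<Rightarrow> real ^ 2"

definition periodic_grid :: "nat \<Rightarrow> grid \<Rightarrow> bool" where
  "periodic_grid N u \<longleftrightarrow> (\<forall>i. u (i + int N) = u i)"

definition mesh_width :: "nat \<Rightarrow> real" where
  "mesh_width N = 2 * pi / real N"

definition grid_norm :: "nat \<Rightarrow> grid \<Rightarrow> real" where
  "grid_norm N u = sqrt (mesh_width N * (\<Sum>i\<in>{0..<int N}. (norm (u i))\<^sup>2))"

definition mat_A :: "real ^ 2 ^ 2" where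
  "mat_A = vector [vector [- (79 / 456), - (63 / 76)],
                   vector [79 / 912, 63 / 152]]"

definition mat_B :: "real ^ 2 ^ 2" where
  "mat_B = vector [vector [115 / 152, 63 / 76],
                   vector [- (187 / 912), 63 / 152]]"

definition mat_C :: "real ^ 2 ^ 2" where
  "mat_C = vector [vector [1 / 152, - (177 / 76)],
                   vector [377 / 912, 177 / 152]]"

definition mat_D :: "real ^ 2 ^ 2" where
  "mat_D = vector [vector [- (269 / 456), 177 / 76],
                   vector [- (269 / 912), 177 / 152]]"

definition semi_discrete :: "real \<Rightarrow> grid \<Rightarrow> grid" where
  "semi_discrete dx u = (\<lambda>i. (1 / dx) *\<^sub>R
     (mat_A *v u (i - 2) + mat_B *v u (i - 1) + mat_C *v u i + mat_D *v u (i + 1)))"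

text \<open>
  The matrices arise from the finite volume form with the upwind value \<open>u\<^sup>-\<close> at the right
  interface of cell \<open>i\<close>.
\<close>

definition upwind_value :: "grid \<Rightarrow> int \<Rightarrow> real" where
  "upwind_value u i =
     - (79 / 456) * u (i - 1) $ 1 + 7 / 12 * u i $ 1 + 269 / 456 * u (i + 1) $ 1
     - 63 / 76 * u (i - 1) $ 2 - 177 / 76 * u (i + 1) $ 2"

lemma semi_discrete_flux_form:
  "semi_discrete dx u i $ 1 = - (1 / dx) * (upwind_value u i - upwind_value u (i - 1))"
  "semi_discrete dx u i $ 2 =
     - (1 / (2 * dx)) * (upwind_value u (i - 1) + upwind_value u i) + 1 / dx * u i $ 1"
  by (cases "dx = 0";
      simp add: semi_discrete_def upwind_value_def mat_A_def mat_B_def mat_C_def mat_D_def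
        matrix_vector_mult_def sum_2 field_simps)+

definition forward_euler :: "real \<Rightarrow> real \<Rightarrow> grid \<Rightarrow> grid" where
  "forward_euler dt dx u = (\<lambda>i. u i + dt *\<^sub>R semi_discrete dx u i)"

definition ssp_rk3 :: "real \<Rightarrow> real \<Rightarrow> grid \<Rightarrow> grid" where
  "ssp_rk3 dt dx u =
    (let u1 = (\<lambda>i. u i + dt *\<^sub>R semi_discrete dx u i);
         u2 = (\<lambda>i. (3 / 4) *\<^sub>R u i + (1 / 4) *\<^sub>R (u1 i + dt *\<^sub>R semi_discrete dx u1 i))
     in (\<lambda>i. (1 / 3) *\<^sub>R u i + (2 / 3) *\<^sub>R (u2 i + dt *\<^sub>R semi_discrete dx u2 i)))"

text \<open>
  Here \<open>step dt dx\<close> advances a grid function by one time step.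
\<close>

definition stable_scheme :: "(real \<Rightarrow> real \<Rightarrow> grid \<Rightarrow> grid) \<Rightarrow> real \<Rightarrow> bool" where
  "stable_scheme step \<nu> \<longleftrightarrow>
    (\<forall>T>0. \<exists>C. \<forall>N\<ge>4. \<forall>u0. periodic_grid N u0 \<longrightarrow>
      (let dx = mesh_width N; dt = \<nu> * dx in
        \<forall>n. real n * dt \<le> T \<longrightarrow>
          grid_norm N ((step dt dx ^^ n) u0) \<le> C * grid_norm N u0))"

end

theory Submission
  imports Defs
begin

text \<open>
  The grid functions whose cells all equal \<open>(0, c)\<close> are eigenvectors of the spatial operator with
  the positive eigenvalue \<open>60 / (19 dx)\<close>.  On them each time step is multiplication by
  \<open>R (60 \<nu> / 19)\<close>, where \<open>R\<close> is the stability polynomial of the time discretization, and this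
  factor exceeds \<open>1\<close> for every \<open>\<nu> > 0\<close>.  Up to a fixed time about \<open>N\<close> steps are made, so the
  growth is exponential in \<open>N\<close>.
\<close>

definition moment_mode :: "real \<Rightarrow> grid" where
  "moment_mode c = (\<lambda>_. vector [0, c])"

lemma scaleR_moment_mode: "a *\<^sub>R moment_mode c i = moment_mode (a * c) i"
  by (simp add: moment_mode_def vec_eq_iff forall_2)

lemma add_moment_mode: "moment_mode b i + moment_mode c i = moment_mode (b + c) i"
  by (simp add: moment_mode_def vec_eq_iff forall_2)

text \<open>Every interface value equals \<open>- (63 + 177) / 76 * c = - 60 / 19 * c\<close>: the
  flux difference in the first component vanishes, while the interface average in the second keeps
  the factor.\<close>

lemma semi_discrete_moment_mode:
  "semi_discrete dx (moment_mode c) = moment_mode (60 / 19 * c / dx)"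
proof
  fix i
  show "semi_discrete dx (moment_mode c) i = moment_mode (60 / 19 * c / dx) i"
    \<comment> \<open>For \<open>dx = 0\<close> both sides vanish, since division by zero yields
      zero.\<close>
    by (cases "dx = 0";
      simp add: vec_eq_iff forall_2 semi_discrete_flux_form upwind_value_def moment_mode_def
        field_simps)
qed

lemma forward_euler_moment_mode:
  assumes "dx \<noteq> 0"
  shows "forward_euler (\<nu> * dx) dx (moment_mode c) = moment_mode ((1 + 60 / 19 * \<nu>) * c)"
  using assms
  by (simp add: forward_euler_def semi_discrete_moment_mode scaleR_moment_mode add_moment_mode
      algebra_simps)

text \<open>Each Euler substep multiplies the mode by \<open>1 + z\<close>; the convex combinations
  of the stages then give the cubic Taylor polynomial of the exponential.\<close>

lemma ssp_rk3_moment_mode: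
  assumes "dx \<noteq> 0" and z: "z = 60 / 19 * \<nu>"
  shows "ssp_rk3 (\<nu> * dx) dx (moment_mode c) = moment_mode ((1 + z + z\<^sup>2 / 2 + z ^ 3 / 6) * c)"
proof -
  have "\<nu> * dx * (60 / 19 * b / dx) = z * b" for b
    using assms by simp
  then have step: "moment_mode b i + (\<nu> * dx) *\<^sub>R semi_discrete dx (moment_mode b) i
      = moment_mode ((1 + z) * b) i" for b i
    by (simp only: semi_discrete_moment_mode scaleR_moment_mode add_moment_mode)
      (simp add: algebra_simps)
  show ?thesis
    unfolding ssp_rk3_def Let_def
    by (simp only: step scaleR_moment_mode add_moment_mode)
      (intro ext arg_cong[where f = "\<lambda>b. moment_mode b _"],
        simp add: field_simps power2_eq_square power3_eq_cube)
qed

lemma grid_norm_moment_mode: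
  "grid_norm N (moment_mode c) = \<bar>c\<bar> * grid_norm N (moment_mode 1)"
proof -
  have "norm (moment_mode c i) = \<bar>c\<bar> * norm (moment_mode 1 i)" for i
    by (metis mult.right_neutral norm_scaleR scaleR_moment_mode)
  then have "(\<Sum>i\<in>{0..<int N}. (norm (moment_mode c i))\<^sup>2)
      = c\<^sup>2 * (\<Sum>i\<in>{0..<int N}. (norm (moment_mode 1 i))\<^sup>2)"
    by (simp add: power_mult_distrib sum_distrib_left)
  then show ?thesis
    by (simp add: grid_norm_def real_sqrt_mult)
qed

text \<open>Allows the norm of the mode to be cancelled from a stability estimate.\<close>

lemma grid_norm_moment_mode_pos:
  assumes "N > 0"
  shows "grid_norm N (moment_mode 1) > 0"
proof -
  have "moment_mode 1 i \<noteq> 0" for i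
    unfolding moment_mode_def by (metis vector_2(2) zero_index zero_neq_one)
  then have "(\<Sum>i\<in>{0..<int N}. (norm (moment_mode 1 i))\<^sup>2) > 0"
    using assms by (intro sum_pos) auto
  then show ?thesis
    using assms by (simp add: grid_norm_def mesh_width_def)
qed

text \<open>Stability up to one fixed time would bound \<open>g ^ N\<close> uniformly in
  \<open>N\<close>, contradicting \<open>g > 1\<close>.\<close>

lemma not_stable_scheme_if_mode_grows:
  assumes "\<nu> > 0" and "g > 1"
    and step: "\<And>dx c. dx > 0 \<Longrightarrow> step (\<nu> * dx) dx (moment_mode c) = moment_mode (g * c)"
  shows "\<not> stable_scheme step \<nu>"
proof
  assume "stable_scheme step \<nu>"
  \<comment> \<open>The final time \<open>2 * pi * \<nu>\<close> is reached after exactly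
    \<open>N\<close> steps of length \<open>\<nu> * mesh_width N\<close>.\<close>
  moreover have "2 * pi * \<nu> > 0"
    using \<open>\<nu> > 0\<close> by simp
  ultimately obtain C where C: "\<And>N u n. N \<ge> 4 \<Longrightarrow> periodic_grid N u \<Longrightarrow>
      real n * (\<nu> * mesh_width N) \<le> 2 * pi * \<nu> \<Longrightarrow>
      grid_norm N ((step (\<nu> * mesh_width N) (mesh_width N) ^^ n) u) \<le> C * grid_norm N u"
    unfolding stable_scheme_def Let_def by meson
  have bound: "g ^ N \<le> C" if "N \<ge> 4" for N
  proof -
    define dx where "dx = mesh_width N"
    have "dx > 0"
      using that by (simp add: dx_def mesh_width_def)
    have "(step (\<nu> * dx) dx ^^ n) (moment_mode 1) = moment_mode (g ^ n)" for n
      by (induction n) (simp_all add: step \<open>dx > 0\<close>)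
    moreover have "periodic_grid N (moment_mode 1)"
      by (simp add: periodic_grid_def moment_mode_def)
    moreover have "real N * (\<nu> * dx) \<le> 2 * pi * \<nu>"
      using that by (simp add: dx_def mesh_width_def)
    ultimately have "grid_norm N (moment_mode (g ^ N)) \<le> C * grid_norm N (moment_mode 1)"
      using C[of N "moment_mode 1" N] that by (simp add: dx_def)
    moreover have "grid_norm N (moment_mode (g ^ N)) = g ^ N * grid_norm N (moment_mode 1)"
      using \<open>g > 1\<close> by (subst grid_norm_moment_mode) simp
    ultimately show ?thesis
      using grid_norm_moment_mode_pos[of N] that by simp
  qed
  obtain n where "C < g ^ n"
    using real_arch_pow[OF \<open>g > 1\<close>] by blast
  \<comment> \<open>The shift by 4 makes the exponent an admissible number of cells.\<close>
  also have "\<dots> \<le> g ^ (n + 4)"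
    using \<open>g > 1\<close> by (intro power_increasing) auto
  also have "\<dots> \<le> C"
    by (rule bound) simp
  finally show False
    by simp
qed

theorem theorem2p1:
  shows "\<not> (\<exists>\<nu>::real. \<nu> > 0 \<and> stable_scheme forward_euler \<nu>) \<and>
         \<not> (\<exists>\<nu>::real. \<nu> > 0 \<and> stable_scheme ssp_rk3 \<nu>)"
proof -
  have "\<not> stable_scheme forward_euler \<nu>" if "\<nu> > 0" for \<nu>
    using not_stable_scheme_if_mode_grows[where step = forward_euler and g = "1 + 60 / 19 * \<nu>"]
      forward_euler_moment_mode that by simp
  moreover have "\<not> stable_scheme ssp_rk3 \<nu>" if "\<nu> > 0" for \<nu>
  proof -
    define z where "z = 60 / 19 * \<nu>"
    have "1 + z + z\<^sup>2 / 2 + z ^ 3 / 6 > 1"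
      using that by (simp add: z_def add_pos_pos)
    then show ?thesis
      \<comment> \<open>Irreflexivity of \<open><\<close> supplies \<open>dx \<noteq> 0\<close> from
        \<open>dx > 0\<close>.\<close>
      using not_stable_scheme_if_mode_grows[where step = ssp_rk3] ssp_rk3_moment_mode[OF _ z_def] that
      by (metis less_irrefl)
  qed
  ultimately show ?thesis
    by blast
qed

end
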